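(* Let $a>1$ be an integer and let $n$ be an odd composite number with $\gcd(n,a)=1$ and prime factorization $n=p_1^{l_1}\cdots p_k^{l_k}$. Then $n$ is an overpseudoprime to base $a$ if and only if for every vector of integers $(i_1,\ldots,i_k)$ with $0\le i_j\le l_j$ for all $j$ and not all $i_j=0$, we have $h_a(n)=h_a(p_1^{i_1}\cdots p_k^{i_k})$.
   Context: For an integer $a>1$ and an integer $m>1$ with $\gcd(m,a)=1$, $h_a(m)$ denotes the multiplicative order of $a$ modulo $m$. The cyclotomic cosets of $a$ modulo $m$ are the orbits of $\{1,2,\ldots,m-1\}$ under $x\mapsto ax\bmod m$; $r_a(m)$ denotes their number. An odd composite number $n$ with $\gcd(n,a)=1$ is called an overpseudoprime to base $a$ if $n=r_a(n)h_a(n)+1$. *)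

theory Defs
  imports "HOL-Number_Theory.Number_Theory" "HOL-Combinatorics.Orbits"
begin

text \<open>
  The multiplicative order \<open>h\<^sub>a(m)\<close> is \<open>ord m a\<close> (modulus first).

  The library's \<open>orbit f x\<close> is \<open>{(f ^^ k) x | k. k > 0}\<close>. It is the usual orbit, with \<open>x\<close>
  itself included, as \<open>x \<mapsto> a x mod m\<close> permutes \<open>{1..m - 1}\<close> when \<open>a\<close> and \<open>m\<close> are coprime.
\<close>

definition cyclotomic_cosets :: "nat \<Rightarrow> nat \<Rightarrow> nat set set" where
  "cyclotomic_cosets a m = orbit (\<lambda>x. a * x mod m) ` {1..m - 1}"

definition num_cyclotomic_cosets :: "nat \<Rightarrow> nat \<Rightarrow> nat" where
  "num_cyclotomic_cosets a m = card (cyclotomic_cosets a m)"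

definition overpseudoprime :: "nat \<Rightarrow> nat \<Rightarrow> bool" where
  "overpseudoprime a n \<longleftrightarrow>
     1 < a \<and> odd n \<and> 1 < n \<and> \<not> prime n \<and> coprime n a \<and>
     n = num_cyclotomic_cosets a n * ord n a + 1"

end

theory Submission
  imports Defs
begin

text \<open>
  Under \<open>x \<mapsto> a x mod n\<close> the orbit of \<open>x\<close> has size \<open>ord (n div gcd n x) a\<close>, which divides
  \<open>ord n a\<close>. Since the orbits partition the \<open>n - 1\<close> nonzero residues, \<open>n - 1\<close> equals the number
  of orbits times \<open>ord n a\<close> exactly when all orbits have the maximal size \<open>ord n a\<close>. The
  quotients \<open>n div gcd n x\<close> run through all divisors of \<open>n\<close> other than \<open>1\<close>.
\<close>

text \<open>The first \<open>d\<close> iterates exhaust the orbit, so only their distinctness is at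
  stake. If iterates \<open>i < j < d\<close> agreed, applying \<open>f\<close> another
  \<open>d - j\<close> times would return to \<open>x\<close> after \<open>d - j + i\<close> steps,
  which lies strictly between \<open>0\<close> and \<open>d\<close>.\<close>

lemma card_orbit_eq_period:
  assumes "0 < d" and period: "\<And>k. (f ^^ k) x = x \<longleftrightarrow> d dvd k"
  shows "card (orbit f x) = d"
proof -
  have "orbit f x = (\<lambda>m. (f ^^ m) x) ` {..<d}"
    using orbit_altdef_bounded[of d f x] assms by auto
  moreover have "(f ^^ i) x \<noteq> (f ^^ j) x" if "i < j" "j < d" for i j
  proof
    assume eq: "(f ^^ i) x = (f ^^ j) x"
    have "(f ^^ (d - j + i)) x = (f ^^ (d - j)) ((f ^^ j) x)"
      by (simp add: funpow_add eq)
    also have "\<dots> = (f ^^ (d - j + j)) x"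
      by (simp only: funpow_add comp_def)
    also have "\<dots> = x"
      using that period[of d] by simp
    finally have "d dvd d - j + i"
      using period by blast
    then show False
      using that by (auto dest: dvd_imp_le)
  qed
  then have "inj_on (\<lambda>m. (f ^^ m) x) {..<d}"
    by (intro linorder_inj_onI) auto
  ultimately show ?thesis
    by (simp add: card_image)
qed

lemma funpow_mult_mod:
  fixes a n x :: nat
  assumes "x < n"
  shows "((\<lambda>x. a * x mod n) ^^ k) x = a ^ k * x mod n"
  using assms by (induction k) (simp_all add: mod_mult_right_eq mult.assoc)

lemma cong_mult_self_right_iff:
  fixes b n x :: nat
  assumes "0 < n"
  shows "[b * x = x] (mod n) \<longleftrightarrow> [b = 1] (mod (n div gcd n x))"
proof -
  define g where "g = gcd n x"
  have "g > 0"
    using assms by (simp add: g_def)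
  obtain m y where m: "n = m * g" and y: "x = y * g" and "coprime m y"
    using gcd_coprime_exists[of n x] \<open>g > 0\<close> unfolding g_def by blast
  \<comment> \<open>The common factor \<open>g\<close> cancels from both sides and from the modulus;
    the cofactor \<open>y\<close> is then invertible modulo \<open>m\<close> and cancels
    too.\<close>
  have "[b * x = x] (mod n) \<longleftrightarrow> [b * y = 1 * y] (mod m)"
    using \<open>g > 0\<close> by (simp add: m y cong_def mult_mod_left flip: mult.assoc)
  also have "\<dots> \<longleftrightarrow> [b = 1] (mod m)"
    using \<open>coprime m y\<close> by (intro cong_mult_rcancel_nat) (simp add: coprime_commute)
  also have "m = n div gcd n x"
    using \<open>g > 0\<close> m by (metis g_def nonzero_mult_div_cancel_right less_numeral_extra(3))
  finally show ?thesis .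
qed

text \<open>This identifies the period of \<open>x\<close>: the return times are the
  \<open>k\<close> with \<open>a ^ k\<close> congruent to 1 modulo \<open>n div gcd n x\<close>. If
  \<open>a\<close> is not invertible there, \<open>ord\<close> is 0 by default and only
  \<open>k = 0\<close> returns.\<close>

lemma funpow_mult_mod_eq_self_iff:
  fixes a n x :: nat
  assumes "x < n"
  shows "((\<lambda>x. a * x mod n) ^^ k) x = x \<longleftrightarrow> ord (n div gcd n x) a dvd k"
proof -
  have "((\<lambda>x. a * x mod n) ^^ k) x = x \<longleftrightarrow> [a ^ k * x = x] (mod n)"
    using assms by (simp add: funpow_mult_mod cong_def)
  then show ?thesis
    using assms cong_mult_self_right_iff ord_divides by auto
qed

lemma ord_div_gcd_pos:
  fixes a n x :: nat
  assumes "coprime n a"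
  shows "0 < ord (n div gcd n x) a"
proof -
  have "n div gcd n x dvd n"
    by (metis dvd_mult_div_cancel dvd_triv_right gcd_dvd1)
  then have "coprime (n div gcd n x) a"
    using coprime_divisors[OF _ dvd_refl assms] by simp
  then show ?thesis
    by (metis ord_eq_0 gr0I)
qed

text \<open>A power of \<open>a\<close> that is 1 modulo \<open>n\<close> is 1 modulo every divisor
  of \<open>n\<close>.\<close>

lemma ord_dvd_mono:
  fixes a m n :: nat
  assumes "m dvd n"
  shows "ord m a dvd ord n a"
  using cong_dvd_modulus_nat[OF ord assms] by (simp only: ord_divides)

lemma card_orbit_mult_mod:
  fixes a n x :: nat
  assumes "coprime n a" "x < n"
  shows "card (orbit (\<lambda>x. a * x mod n) x) = ord (n div gcd n x) a"
  using assms by (intro card_orbit_eq_period ord_div_gcd_pos funpow_mult_mod_eq_self_iff)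

text \<open>Since \<open>orbit\<close> collects positive iterates only, membership needs a positive
  return time; the period is one.\<close>

lemma self_in_orbit_mult_mod:
  fixes a n x :: nat
  assumes "coprime n a" "x < n"
  shows "x \<in> orbit (\<lambda>x. a * x mod n) x"
proof -
  have "((\<lambda>x. a * x mod n) ^^ ord (n div gcd n x) a) x = x"
    using assms by (simp add: funpow_mult_mod_eq_self_iff)
  then show ?thesis
    using ord_div_gcd_pos[OF assms(1)] by (metis (mono_tags, lifting) orbit_altdef mem_Collect_eq)
qed

lemma orbit_mult_mod_subset:
  fixes a n x :: nat
  assumes "coprime n a" "x \<in> {1..n - 1}"
  shows "orbit (\<lambda>x. a * x mod n) x \<subseteq> {1..n - 1}"
proof
  fix y assume "y \<in> orbit (\<lambda>x. a * x mod n) x"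
  then obtain k where "y = ((\<lambda>x. a * x mod n) ^^ k) x"
    by (auto simp: orbit_altdef)
  then have y: "y = a ^ k * x mod n"
    using assms by (subst (asm) funpow_mult_mod) auto
  have "\<not> n dvd a ^ k * x"
  proof
    assume "n dvd a ^ k * x"
    then have "n dvd x"
      using assms(1) by (simp add: coprime_dvd_mult_right_iff)
    then show False
      using assms(2) by (auto dest: dvd_imp_le)
  qed
  then have "y \<noteq> 0"
    using y by (simp add: dvd_eq_mod_eq_0)
  moreover have "y < n"
    unfolding y using assms(2) by (intro mod_less_divisor) auto
  ultimately show "y \<in> {1..n - 1}"
    by simp
qed

lemma sum_card_cyclotomic_cosets:
  assumes "coprime n a"
  shows "(\<Sum>c\<in>cyclotomic_cosets a n. card c) = n - 1"
proof -
  let ?f = "\<lambda>x. a * x mod n"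
  have self: "x \<in> orbit ?f x" if "x \<in> {1..n - 1}" for x
    using that assms by (intro self_in_orbit_mult_mod) auto
  have "pairwise disjnt (cyclotomic_cosets a n)"
  proof (intro pairwiseI)
    fix C D
    assume "C \<in> cyclotomic_cosets a n" "D \<in> cyclotomic_cosets a n" "C \<noteq> D"
    then obtain x y where xy: "x \<in> {1..n - 1}" "y \<in> {1..n - 1}"
      and C: "C = orbit ?f x" and D: "D = orbit ?f y"
      unfolding cyclotomic_cosets_def by blast
    have "C = D" if "z \<in> C" "z \<in> D" for z
    proof -
      \<comment> \<open>Self-membership makes the orbit relation symmetric, so a shared
        \<open>z\<close> leads back to both \<open>x\<close> and \<open>y\<close>.\<close>
      have "x \<in> orbit ?f z" "y \<in> orbit ?f z"
        using that self xy by (auto simp: C D intro: orbit_swap)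
      then show ?thesis
        using that unfolding C D by (blast intro: orbit_trans)
    qed
    then show "disjnt C D"
      using \<open>C \<noteq> D\<close> by (auto simp: disjnt_def)
  qed
  moreover have "finite C" if "C \<in> cyclotomic_cosets a n" for C
    using that self by (auto simp: cyclotomic_cosets_def intro: finite_orbit)
  ultimately have "card (\<Union> (cyclotomic_cosets a n)) = (\<Sum>c\<in>cyclotomic_cosets a n. card c)"
    by (rule card_Union_disjoint)
  moreover have "\<Union> (cyclotomic_cosets a n) = {1..n - 1}"
    using orbit_mult_mod_subset[OF assms] self unfolding cyclotomic_cosets_def by blast
  ultimately show ?thesis
    by simp
qed

lemma num_cyclotomic_cosets_mult_ord_iff:
  assumes "1 < n" "coprime n a"
  shows "n = num_cyclotomic_cosets a n * ord n a + 1 \<longleftrightarrow>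
    (\<forall>x\<in>{1..n - 1}. ord (n div gcd n x) a = ord n a)"
proof -
  let ?C = "cyclotomic_cosets a n"
  have card: "card (orbit (\<lambda>x. a * x mod n) x) = ord (n div gcd n x) a" if "x \<in> {1..n - 1}" for x
    using that assms by (intro card_orbit_mult_mod) auto
  have "ord (n div gcd n x) a \<le> ord n a" for x
  proof -
    have "n div gcd n x dvd n"
      by (metis dvd_mult_div_cancel dvd_triv_right gcd_dvd1)
    then show ?thesis
      \<comment> \<open>Divisibility gives the inequality because coprimality makes
        \<open>ord n a\<close> positive.\<close>
      using assms(2) by (intro dvd_imp_le ord_dvd_mono) (auto simp: ord_eq_0 intro: Nat.gr0I)
  qed
  then have le: "card c \<le> ord n a" if "c \<in> ?C" for c
    using that card by (auto simp: cyclotomic_cosets_def)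
  have "finite ?C"
    by (simp add: cyclotomic_cosets_def)
  have "n = num_cyclotomic_cosets a n * ord n a + 1 \<longleftrightarrow> sum card ?C = (\<Sum>c\<in>?C. ord n a)"
    using assms by (auto simp: sum_card_cyclotomic_cosets num_cyclotomic_cosets_def)
  \<comment> \<open>Each term on the left is at most its counterpart on the right, so equal sums
    force equality term by term.\<close>
  also have "\<dots> \<longleftrightarrow> (\<forall>c\<in>?C. card c = ord n a)"
    using sum_mono_inv[OF _ le _ \<open>finite ?C\<close>] by auto
  also have "\<dots> \<longleftrightarrow> (\<forall>x\<in>{1..n - 1}. ord (n div gcd n x) a = ord n a)"
    using card by (simp add: cyclotomic_cosets_def)
  finally show ?thesis .
qed

lemma all_div_gcd_iff_all_dvd:
  fixes n :: nat
  assumes "0 < n"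
  shows "(\<forall>x\<in>{1..n - 1}. P (n div gcd n x)) \<longleftrightarrow> (\<forall>d. d dvd n \<and> d \<noteq> 1 \<longrightarrow> P d)"
proof (intro iffI allI ballI impI)
  fix d assume all: "\<forall>x\<in>{1..n - 1}. P (n div gcd n x)" and d: "d dvd n \<and> d \<noteq> 1"
  \<comment> \<open>The cofactor \<open>e\<close> serves as the residue: \<open>gcd n e = e\<close>
    gives the quotient \<open>d\<close>, and \<open>d \<noteq> 1\<close> ensures
    \<open>e < n\<close>.\<close>
  then obtain e where e: "n = d * e" by blast
  have "0 < e" "1 < d"
    using assms d e by (auto intro: Nat.gr0I simp: nat_neq_iff)
  then have "e < n" "n div gcd n e = d"
    by (auto simp: e)
  then have "e \<in> {1..n - 1}"
    using \<open>0 < e\<close> by auto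
  then show "P d"
    using all \<open>n div gcd n e = d\<close> by metis
next
  fix x assume all: "\<forall>d. d dvd n \<and> d \<noteq> 1 \<longrightarrow> P d" and x: "x \<in> {1..n - 1}"
  have n: "n = n div gcd n x * gcd n x"
    by simp
  then have "n div gcd n x dvd n"
    by (metis dvd_triv_left)
  moreover have "n div gcd n x \<noteq> 1"
  proof
    assume "n div gcd n x = 1"
    \<comment> \<open>Quotient 1 means \<open>gcd n x = n\<close>, which is impossible for
      \<open>0 < x < n\<close>.\<close>
    then have "n dvd x"
      using n by (metis gcd_dvd2 mult_1)
    then show False
      using x by (auto dest: dvd_imp_le)
  qed
  ultimately show "P (n div gcd n x)"
    using all by blast
qed

lemma dvd_prod_prime_powers_iff:
  fixes p l :: "'b \<Rightarrow> nat"
  assumes "finite A" "\<And>j. j \<in> A \<Longrightarrow> prime (p j)"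
  shows "d dvd (\<Prod>j\<in>A. p j ^ l j) \<longleftrightarrow> (\<exists>i. (\<forall>j\<in>A. i j \<le> l j) \<and> d = (\<Prod>j\<in>A. p j ^ i j))"
proof
  assume "d dvd (\<Prod>j\<in>A. p j ^ l j)"
  with assms show "\<exists>i. (\<forall>j\<in>A. i j \<le> l j) \<and> d = (\<Prod>j\<in>A. p j ^ i j)"
  proof (induction A arbitrary: d rule: finite_induct)
    case (insert x A)
    then have "d dvd p x ^ l x * (\<Prod>j\<in>A. p j ^ l j)"
      by simp
    \<comment> \<open>A divisor of a product splits into divisors of the factors: \<open>b\<close>
      is a power of \<open>p x\<close>, and \<open>c\<close> is covered by induction.\<close>
    then obtain b c where d: "d = b * c" and "b dvd p x ^ l x" "c dvd (\<Prod>j\<in>A. p j ^ l j)"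
      using division_decomp by blast
    obtain e where "e \<le> l x" "b = p x ^ e"
      using divides_primepow_nat[of "p x" b "l x"] insert.prems \<open>b dvd p x ^ l x\<close> by auto
    moreover obtain i where "\<forall>j\<in>A. i j \<le> l j" and c: "c = (\<Prod>j\<in>A. p j ^ i j)"
      using insert.IH[OF _ \<open>c dvd _\<close>] insert.prems by auto
    \<comment> \<open>Setting the exponent at \<open>x\<close> leaves the product over
      \<open>A\<close> unchanged, as \<open>x\<close> is not in \<open>A\<close>.\<close>
    moreover have "c = (\<Prod>j\<in>A. p j ^ (i(x := e)) j)"
      unfolding c using insert.hyps by (intro prod.cong) auto
    ultimately show ?case
      using insert.hyps d by (intro exI[of _ "i(x := e)"]) auto
  qed simp
next
  assume "\<exists>i. (\<forall>j\<in>A. i j \<le> l j) \<and> d = (\<Prod>j\<in>A. p j ^ i j)"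
  then show "d dvd (\<Prod>j\<in>A. p j ^ l j)"
    by (auto intro!: prod_dvd_prod le_imp_power_dvd)
qed

theorem theorem7:
  fixes a n k :: nat and p l :: "nat \<Rightarrow> nat"
  assumes "1 < a"
    and "odd n" and "1 < n" and "\<not> prime n" and "coprime n a"
    and "\<And>j. j \<in> {1..k} \<Longrightarrow> prime (p j)"
    and "inj_on p {1..k}"
    and "\<And>j. j \<in> {1..k} \<Longrightarrow> 1 \<le> l j"
    and "n = (\<Prod>j=1..k. p j ^ l j)"
  shows "overpseudoprime a n \<longleftrightarrow>
    (\<forall>i :: nat \<Rightarrow> nat.
       (\<forall>j\<in>{1..k}. i j \<le> l j) \<and> (\<exists>j\<in>{1..k}. i j \<noteq> 0) \<longrightarrow>
       ord n a = ord (\<Prod>j=1..k. p j ^ i j) a)"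
proof -
  \<comment> \<open>Exponent vectors are functions whose values outside \<open>{1..k}\<close> are
    arbitrary; \<open>N\<close> ignores these values.\<close>
  define I where "I = {i. \<forall>j\<in>{1..k}. i j \<le> l j}"
  define N where "N i = (\<Prod>j=1..k. p j ^ i j)" for i
  have p_neq_1: "p j \<noteq> 1" if "j \<in> {1..k}" for j
    using assms(6)[OF that] by (auto simp: prime_nat_iff)
  have N_neq_1_iff: "N i \<noteq> 1 \<longleftrightarrow> (\<exists>j\<in>{1..k}. i j \<noteq> 0)" for i
  proof -
    have "N i = 1 \<longleftrightarrow> (\<forall>j\<in>{1..k}. p j ^ i j = 1)"
      unfolding N_def by (rule prod_eq_1_iff) simp
    also have "\<dots> \<longleftrightarrow> (\<forall>j\<in>{1..k}. i j = 0)"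
    proof (rule ball_cong[OF refl])
      fix j assume "j \<in> {1..k}"
      then show "p j ^ i j = 1 \<longleftrightarrow> i j = 0"
        using p_neq_1[of j] by simp
    qed
    finally show ?thesis by simp
  qed
  have dvd_n_iff: "d dvd n \<longleftrightarrow> (\<exists>i\<in>I. d = N i)" for d
    unfolding assms(9) I_def N_def Bex_def mem_Collect_eq
    by (rule dvd_prod_prime_powers_iff) (use assms(6) in auto)
  have "overpseudoprime a n \<longleftrightarrow> n = num_cyclotomic_cosets a n * ord n a + 1"
    using assms(1-5) by (simp add: overpseudoprime_def)
  also have "\<dots> \<longleftrightarrow> (\<forall>x\<in>{1..n - 1}. ord (n div gcd n x) a = ord n a)"
    by (rule num_cyclotomic_cosets_mult_ord_iff[OF assms(3,5)])
  also have "\<dots> \<longleftrightarrow> (\<forall>d. d dvd n \<and> d \<noteq> 1 \<longrightarrow> ord d a = ord n a)"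
    using assms(3) by (intro all_div_gcd_iff_all_dvd) simp
  \<comment> \<open>The divisors of \<open>n\<close> are exactly the values of \<open>N\<close> on
    \<open>I\<close>, so quantifying over divisors becomes quantifying over exponent
    vectors.\<close>
  also have "\<dots> \<longleftrightarrow> (\<forall>i. i \<in> I \<and> N i \<noteq> 1 \<longrightarrow> ord n a = ord (N i) a)"
    unfolding dvd_n_iff by metis
  finally show ?thesis
    unfolding N_neq_1_iff unfolding I_def N_def mem_Collect_eq .
qed

end
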